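(* Each of the following is a basis for the vector space $V$: \[ \{y^{\downarrow\downarrow}\}_{y\in X},\qquad \{y^{\uparrow\downarrow}\}_{y\in X},\qquad \{y^{\downarrow\uparrow}\}_{y\in X},\qquad \{y^{\uparrow\uparrow}\}_{y\in X}. \]
   Context: Let $q$ be a prime power, $GF(q)$ the field with $q$ elements, $N\ge 1$ an integer, and $\mathbf V$ an $N$-dimensional vector space over $GF(q)$. Let $X$ be the set of all subspaces of $\mathbf V$, ordered by inclusion (the projective geometry $L_N(q)$). For $y,z\in X$, $y$ covers $z$ means $z\subseteq y$ and $\dim y-\dim z=1$. ${\rm Mat}_X(\mathbb C)$ is the algebra of complex matrices with rows and columns indexed by $X$; it acts on $V=\mathbb C^X$ by left multiplication. For $y\in X$, $\hat y\in V$ has $y$-coordinate $1$ and all other coordinates $0$. $A^*\in{\rm Mat}_X(\mathbb C)$ is the diagonal matrix with $(y,y)$-entry $q^{-\dim y}$. $R,L\in{\rm Mat}_X(\mathbb C)$: $R_{y,z}=1$ if $y$ covers $z$ and $0$ otherwise; $L_{y,z}=1$ if $z$ covers $y$ and $0$ otherwise. Fix a real number $\varphi>0$. With $[n]_q=\frac{q^n-1}{q-1}$ and $[n]_q^!=[n]_q\cdots[1]_q$ ($[0]_q^!=1$), for nilpotent $\psi$ define \[ \exp_{q^{1/2}}(\psi)=\sum_{i\ge0}\frac{q^{i(i-1)/2}}{[i]_q^!}\psi^i,\qquad \exp_{q^{-1/2}}(\psi)=\sum_{i\ge0}\frac{1}{[i]_q^!}\psi^i . \] For $y\in X$ define $y^{\downarrow\downarrow}=\exp_{q^{-1/2}}(L)\hat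 y$, $y^{\uparrow\downarrow}=\exp_{q^{1/2}}(RA^* )\hat y$, $y^{\downarrow\uparrow}=\exp_{q^{-1/2}}(-\varphi L)\hat y$, $y^{\uparrow\uparrow}=\exp_{q^{1/2}}(-\varphi^{-1}RA^* )\hat y$. *)

theory Defs
  imports "HOL-Analysis.Analysis"
begin

text \<open>
  A vector space over the finite field \<open>'k\<close> is given by its scalar multiplication
  \<open>smul :: 'k \<Rightarrow> 'v \<Rightarrow> 'v\<close>, as in the library locale \<^locale>\<open>vector_space\<close>.

  The subspaces do not form a type of their own (they depend on \<open>smul\<close>), so vectors and matrices
  are indexed by the finite type \<open>'v set\<close>.  The space of complex column vectors indexed by the
  subspaces is the space of those vectors all of whose other coordinates vanish, and a matrix
  indexed by the subspaces is extended by zero.  The identity matrix \<^term>\<open>mat 1\<close> acts on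
  that space as the identity.
\<close>

definition subspaces :: "('k::field \<Rightarrow> 'v::ab_group_add \<Rightarrow> 'v) \<Rightarrow> 'v set set" where
  "subspaces smul = {S. module.subspace smul S}"

definition covers :: "('k::field \<Rightarrow> 'v::ab_group_add \<Rightarrow> 'v) \<Rightarrow> 'v set \<Rightarrow> 'v set \<Rightarrow> bool" where
  "covers smul y z \<longleftrightarrow> z \<subseteq> y \<and> int (vector_space.dim smul y) - int (vector_space.dim smul z) = 1"

definition standard_module ::
    "('k::field \<Rightarrow> 'v::{ab_group_add,finite} \<Rightarrow> 'v) \<Rightarrow> (complex ^ 'v set) set" where
  "standard_module smul = {v. \<forall>y. y \<notin> subspaces smul \<longrightarrow> v $ y = 0}"

definition hat :: "'x::finite \<Rightarrow> complex ^ 'x" where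
  "hat y = axis y 1"

definition A_star ::
    "nat \<Rightarrow> ('k::field \<Rightarrow> 'v::{ab_group_add,finite} \<Rightarrow> 'v) \<Rightarrow> complex ^ 'v set ^ 'v set" where
  "A_star q smul = (\<chi> y z. if y \<in> subspaces smul \<and> y = z
     then of_nat q powi (- int (vector_space.dim smul y)) else 0)"

definition R_mat ::
    "('k::field \<Rightarrow> 'v::{ab_group_add,finite} \<Rightarrow> 'v) \<Rightarrow> complex ^ 'v set ^ 'v set" where
  "R_mat smul = (\<chi> y z. if y \<in> subspaces smul \<and> z \<in> subspaces smul \<and> covers smul y z
     then 1 else 0)"

definition L_mat ::
    "('k::field \<Rightarrow> 'v::{ab_group_add,finite} \<Rightarrow> 'v) \<Rightarrow> complex ^ 'v set ^ 'v set" where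
  "L_mat smul = (\<chi> y z. if y \<in> subspaces smul \<and> z \<in> subspaces smul \<and> covers smul z y
     then 1 else 0)"

definition q_int :: "nat \<Rightarrow> nat \<Rightarrow> real" where
  "q_int q n = (real q ^ n - 1) / (real q - 1)"

definition q_fact :: "nat \<Rightarrow> nat \<Rightarrow> real" where
  "q_fact q n = (\<Prod>i=1..n. q_int q i)"

primrec mat_power :: "complex ^ 'x ^ 'x::finite \<Rightarrow> nat \<Rightarrow> complex ^ 'x ^ 'x" where
  "mat_power M 0 = mat 1"
| "mat_power M (Suc n) = M ** mat_power M n"

text \<open>For nilpotent arguments, the only ones of interest, only finitely many terms of the
  following two series are nonzero.\<close>

definition exp_q_half :: "nat \<Rightarrow> complex ^ 'x ^ 'x::finite \<Rightarrow> complex ^ 'x ^ 'x" where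
  "exp_q_half q M = (\<Sum>i. (real q ^ (i * (i - 1) div 2) / q_fact q i) *\<^sub>R mat_power M i)"

definition exp_q_neg_half :: "nat \<Rightarrow> complex ^ 'x ^ 'x::finite \<Rightarrow> complex ^ 'x ^ 'x" where
  "exp_q_neg_half q M = (\<Sum>i. (1 / q_fact q i) *\<^sub>R mat_power M i)"

definition down_down ::
    "nat \<Rightarrow> ('k::field \<Rightarrow> 'v::{ab_group_add,finite} \<Rightarrow> 'v) \<Rightarrow> 'v set \<Rightarrow> complex ^ 'v set" where
  "down_down q smul y = exp_q_neg_half q (L_mat smul) *v hat y"

definition up_down ::
    "nat \<Rightarrow> ('k::field \<Rightarrow> 'v::{ab_group_add,finite} \<Rightarrow> 'v) \<Rightarrow> 'v set \<Rightarrow> complex ^ 'v set" where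
  "up_down q smul y = exp_q_half q (R_mat smul ** A_star q smul) *v hat y"

definition down_up ::
    "nat \<Rightarrow> real \<Rightarrow> ('k::field \<Rightarrow> 'v::{ab_group_add,finite} \<Rightarrow> 'v) \<Rightarrow> 'v set \<Rightarrow> complex ^ 'v set" where
  "down_up q \<phi> smul y = exp_q_neg_half q ((- \<phi>) *\<^sub>R L_mat smul) *v hat y"

definition up_up ::
    "nat \<Rightarrow> real \<Rightarrow> ('k::field \<Rightarrow> 'v::{ab_group_add,finite} \<Rightarrow> 'v) \<Rightarrow> 'v set \<Rightarrow> complex ^ 'v set" where
  "up_up q \<phi> smul y =
     exp_q_half q ((- inverse \<phi>) *\<^sub>R (R_mat smul ** A_star q smul)) *v hat y"

definition is_basis_family :: "'i set \<Rightarrow> ('i \<Rightarrow> complex ^ 'x::finite) \<Rightarrow> (complex ^ 'x) set \<Rightarrow> bool" where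
  "is_basis_family I f W \<longleftrightarrow> inj_on f I \<and> vec.independent (f ` I) \<and> vec.span (f ` I) = W"

end

theory Submission
  imports Defs
begin

text \<open>
  The matrices \<open>L\<close> and \<open>R A\<^sup>*\<close> are strictly triangular for inclusion and reverse inclusion of
  subspaces, hence nilpotent, and a power series in such a matrix with constant term \<open>1\<close> is
  unitriangular.  Its columns indexed by subspaces therefore span the standard module, and since
  there are only as many of them as the dimension, they form a basis.
\<close>

text \<open>The rank \<open>r\<close> replaces an ordering of the index set. Putting the row index
  in \<open>S\<close> keeps every column of \<open>M\<close> supported on \<open>S\<close>.\<close>

definition strictly_triangular :: "'x set \<Rightarrow> ('x \<Rightarrow> nat) \<Rightarrow> complex ^ 'x ^ 'x::finite \<Rightarrow> bool" where
  "strictly_triangular S r M \<longleftrightarrow> (\<forall>y z. M $ y $ z \<noteq> 0 \<longrightarrow> y \<in> S \<and> r y < r z)"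

lemma strictly_triangular_scaleR:
  "strictly_triangular S r M \<Longrightarrow> strictly_triangular S r (c *\<^sub>R M)"
  by (auto simp: strictly_triangular_def)

text \<open>Each factor \<open>M\<close> lowers the rank by at least one and lands in
  \<open>S\<close>. The zeroth power is a separate case because \<open>mat 1\<close> also has
  diagonal entries outside \<open>S\<close>.\<close>

lemma mat_power_nonzero:
  assumes "strictly_triangular S r M" and "mat_power M n $ y $ z \<noteq> 0"
  shows "r y + n \<le> r z \<and> (n = 0 \<and> y = z \<or> y \<in> S)"
  using assms(2)
proof (induction n arbitrary: y)
  case 0
  then show ?case by (auto simp: mat_def split: if_splits)
next
  case (Suc n)
  then have "(\<Sum>w\<in>UNIV. M $ y $ w * mat_power M n $ w $ z) \<noteq> 0"
    by (simp add: matrix_matrix_mult_def)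
  then obtain w where "M $ y $ w * mat_power M n $ w $ z \<noteq> 0"
    by (meson sum.not_neutral_contains_not_neutral)
  then have "y \<in> S" "r y < r w" "r w + n \<le> r z"
    using assms(1) Suc.IH by (auto simp: strictly_triangular_def)
  then show ?case by simp
qed

lemma strictly_triangular_series_column:
  fixes c :: "nat \<Rightarrow> real" and y :: "'x::finite"
  assumes M: "strictly_triangular S r M" and c: "c 0 = 1"
  defines "v \<equiv> (\<Sum>i. c i *\<^sub>R mat_power M i) *v hat y"
  shows "v $ y = 1" and "v $ z \<noteq> 0 \<Longrightarrow> z = y \<or> z \<in> S \<and> r z < r y"
proof -
  \<comment> \<open>Ranks are bounded on a finite type, so \<open>M\<close> is nilpotent; the
    infinite series becomes a finite sum and no convergence question arises.\<close>
  have "mat_power M i = 0" if "i \<notin> {..Max (range r)}" for i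
  proof -
    have "mat_power M i $ x $ z = 0" for x z
    proof (rule ccontr)
      assume "mat_power M i $ x $ z \<noteq> 0"
      with M have "i \<le> r z" by (auto dest: mat_power_nonzero)
      also have "r z \<le> Max (range r)" by simp
      finally show False using that by simp
    qed
    then show ?thesis by (simp add: vec_eq_iff)
  qed
  then have "(\<Sum>i. c i *\<^sub>R mat_power M i) = (\<Sum>i\<le>Max (range r). c i *\<^sub>R mat_power M i)"
    by (intro suminf_finite) auto
  then have v: "v $ x = (\<Sum>i\<le>Max (range r). c i *\<^sub>R mat_power M i $ x $ y)" for x
    by (simp add: v_def hat_def matrix_vector_mult_def axis_def if_distrib cong: if_cong)
  \<comment> \<open>A diagonal entry of the \<open>i\<close>-th power can be nonzero only if
    \<open>r y + i \<le> r y\<close>, that is, for \<open>i = 0\<close>.\<close>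
  have "v $ y = (\<Sum>i\<in>{0}. c i *\<^sub>R mat_power M i $ y $ y)"
    unfolding v using mat_power_nonzero[OF M, of _ y y]
    by (intro sum.mono_neutral_right) force+
  then show "v $ y = 1" by (simp add: c mat_def)
  assume "v $ z \<noteq> 0"
  then obtain i where "mat_power M i $ z $ y \<noteq> 0"
    unfolding v by (metis (no_types, lifting) scaleR_zero_right sum.neutral)
  then have i: "r z + i \<le> r y \<and> (i = 0 \<and> z = y \<or> z \<in> S)"
    by (rule mat_power_nonzero[OF M])
  show "z = y \<or> z \<in> S \<and> r z < r y"
  proof (cases "i = 0")
    case True
    with \<open>mat_power M i $ z $ y \<noteq> 0\<close> show ?thesis by (simp add: mat_def split: if_splits)
  qed (use i in auto)
qed

lemma unitriangular_is_basis_family: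
  fixes f :: "'x::finite \<Rightarrow> complex ^ 'x" and r :: "'x \<Rightarrow> nat"
  assumes diag: "\<And>y. y \<in> S \<Longrightarrow> f y $ y = 1"
    and tri: "\<And>y z. \<lbrakk>y \<in> S; f y $ z \<noteq> 0\<rbrakk> \<Longrightarrow> z = y \<or> z \<in> S \<and> r z < r y"
  shows "is_basis_family S f {v. \<forall>y. y \<notin> S \<longrightarrow> v $ y = 0}" (is "is_basis_family S f ?W")
proof -
  have expand: "v = (\<Sum>z\<in>S. v $ z *s hat z)" if "v \<in> ?W" for v
    using that by (auto simp: vec_eq_iff hat_def axis_def if_distrib cong: if_cong)
  have W: "vec.subspace ?W" by (auto simp: vec.subspace_def)
  have fW: "f ` S \<subseteq> ?W" using tri by blast
  have hat_in: "hat y \<in> vec.span (f ` S)" if "y \<in> S" for y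
    using that
  \<comment> \<open>By triangularity \<open>f y - hat y\<close> combines vectors
    \<open>hat z\<close> with \<open>z\<close> in \<open>S\<close> of smaller rank, which are in the
    span by induction.\<close>
  proof (induction "r y" arbitrary: y rule: less_induct)
    case less
    have "f y = (\<Sum>z\<in>S. f y $ z *s hat z)" using fW less.prems by (intro expand) auto
    also have "\<dots> = hat y + (\<Sum>z\<in>S - {y}. f y $ z *s hat z)"
      using less.prems by (subst sum.remove[of _ y]) (auto simp: diag)
    finally have "hat y = f y - (\<Sum>z\<in>S - {y}. f y $ z *s hat z)"
      by (metis add_diff_cancel_right')
    moreover have "f y $ z *s hat z \<in> vec.span (f ` S)" if "z \<in> S - {y}" for z
    proof (cases "f y $ z = 0")
      case False
      then show ?thesis using that less tri by (intro vec.span_scale) blast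
    qed (simp add: vec.span_zero)
    ultimately show ?case using less.prems
      by (metis (no_types, lifting) imageI vec.span_base vec.span_diff vec.span_sum)
  qed
  have "?W \<subseteq> vec.span (hat ` S)"
    by (metis (no_types, lifting) expand imageI subsetI vec.span_base vec.span_scale vec.span_sum)
  then have W_le: "?W \<subseteq> vec.span (f ` S)"
    using vec.span_minimal[OF _ vec.subspace_span] hat_in by (meson image_subsetI order_trans)
  \<comment> \<open>The coordinate vectors indexed by \<open>S\<close> form a basis of
    \<open>?W\<close>, which gives its dimension.\<close>
  have "hat ` S \<subseteq> cart_basis" by (auto simp: hat_def cart_basis_def)
  then have "vec.independent (hat ` S :: (complex ^ 'x) set)"
    using independent_cart_basis vec.independent_mono by blast
  moreover have "hat ` S \<subseteq> ?W" by (auto simp: hat_def axis_def)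
  ultimately have "vec.dim ?W = card (hat ` S :: (complex ^ 'x) set)"
    using \<open>?W \<subseteq> vec.span (hat ` S)\<close> by (intro vec.dim_unique) auto
  also have "\<dots> = card S" by (intro card_image) (auto simp: inj_on_def hat_def axis_eq_axis)
  finally have dim: "vec.dim ?W = card S" .
  \<comment> \<open>A spanning family of \<open>card S\<close> vectors in dimension
    \<open>card S\<close> cannot repeat a vector and must be independent; injectivity and
    independence both come from this count.\<close>
  have "card S \<le> card (f ` S)"
    using vec.dim_le_card[OF W_le] dim by simp
  then have card: "card (f ` S) = card S" using card_image_le[of S f] by simp
  then have "inj_on f S" by (intro eq_card_imp_inj_on) auto
  moreover have "vec.independent (f ` S)"
    using fW W_le card dim by (intro vec.card_le_dim_spanning) auto
  moreover have "vec.span (f ` S) = ?W"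
    using W_le vec.span_minimal[OF fW W] by blast
  ultimately show ?thesis by (simp add: is_basis_family_def)
qed

lemma strictly_triangular_is_basis_family:
  assumes M: "strictly_triangular (subspaces smul) r M" and c: "c 0 = 1"
  shows "is_basis_family (subspaces smul) (\<lambda>y. (\<Sum>i. c i *\<^sub>R mat_power M i) *v hat y)
    (standard_module smul)"
  unfolding standard_module_def
  by (rule unitriangular_is_basis_family[where r = r])
    (use strictly_triangular_series_column[where c = c, OF M c] in blast)+

lemma covers_psubset: "covers smul y z \<Longrightarrow> z \<subset> y"
  by (auto simp: covers_def)

text \<open>Cardinality serves as the rank in place of dimension: a proper inclusion of finite sets
  already makes it strictly larger.\<close>

lemma strictly_triangular_L_mat: "strictly_triangular (subspaces smul) card (L_mat smul)"
  by (auto simp: strictly_triangular_def L_mat_def intro!: psubset_card_mono covers_psubset)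

text \<open>Raising reverses the inclusion, so the rank counts the complement. As
  \<open>A_star\<close> is diagonal, it merely rescales the columns of \<open>R_mat\<close>.\<close>

lemma strictly_triangular_R_mat_A_star:
  "strictly_triangular (subspaces smul) (\<lambda>y. card (- y)) (R_mat smul ** A_star q smul)"
  unfolding strictly_triangular_def
proof (intro allI impI)
  fix y z
  assume "(R_mat smul ** A_star q smul) $ y $ z \<noteq> 0"
  then have "(\<Sum>w\<in>UNIV. R_mat smul $ y $ w * A_star q smul $ w $ z) \<noteq> 0"
    by (simp add: matrix_matrix_mult_def)
  then obtain w where "R_mat smul $ y $ w * A_star q smul $ w $ z \<noteq> 0"
    by (meson sum.not_neutral_contains_not_neutral)
  then have "y \<in> subspaces smul" "covers smul y z"
    by (auto simp: R_mat_def A_star_def split: if_splits)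
  then show "y \<in> subspaces smul \<and> card (- y) < card (- z)"
    by (auto intro!: psubset_card_mono dest: covers_psubset)
qed

theorem lemma15p10:
  fixes smul :: "'k::{field,finite} \<Rightarrow> 'v::{ab_group_add,finite} \<Rightarrow> 'v"
    and q N :: nat and \<phi> :: real
  assumes "CARD('k) = q"
    and "vector_space smul"
    and "vector_space.dim smul (UNIV :: 'v set) = N"
    and "N \<ge> 1"
    and "\<phi> > 0"
  shows "is_basis_family (subspaces smul) (down_down q smul) (standard_module smul) \<and>
    is_basis_family (subspaces smul) (up_down q smul) (standard_module smul) \<and>
    is_basis_family (subspaces smul) (down_up q \<phi> smul) (standard_module smul) \<and>
    is_basis_family (subspaces smul) (up_up q \<phi> smul) (standard_module smul)"
  unfolding down_down_def up_down_def down_up_def up_up_def exp_q_half_def exp_q_neg_half_def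
  \<comment> \<open>All four series have coefficient 1 at index 0, since \<open>q_fact q 0\<close>
    is an empty product; the factors \<open>- \<phi>\<close> and \<open>- inverse \<phi>\<close>
    preserve strict triangularity.\<close>
  by (intro conjI;
      (rule strictly_triangular_is_basis_family,
        (rule strictly_triangular_L_mat strictly_triangular_R_mat_A_star
          strictly_triangular_scaleR[OF strictly_triangular_L_mat]
          strictly_triangular_scaleR[OF strictly_triangular_R_mat_A_star]),
        simp add: q_fact_def))

end
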